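(* Assume (A1)–(A4) (see context). Let $(x^k)_{k\in\mathbb{N}}$ be a sequence generated by an infinite run of Algorithm F (as described in the context) such that $x^k\notin S_*$ for all $k\in\mathbb{N}$. Then $(x^k)_{k\in\mathbb{N}}$ converges to a point of $S_*$.
   Context: Setting. $T:\operatorname{dom}(T)\subseteq\mathbb{R}^n\rightrightarrows\mathbb{R}^n$ is a point-to-set operator with $\operatorname{dom}(T)=\{x:T(x)\ne\emptyset\}$ and graph $Gr(T)=\{(x,u):u\in T(x)\}$; $C\subseteq\mathbb{R}^n$ is nonempty, closed and convex; $P_A$ denotes the orthogonal projection onto a nonempty closed convex set $A$. Define $S_*=\{x_*\in C:\exists u_*\in T(x_* ),\ \langle u_*,x-x_*\rangle\ge0\ \forall x\in C\}$ and $S_0=\{x_*\in C:\langle u,x-x_*\rangle\ge0\ \forall x\in C,\ \forall u\in T(x)\}$. Assumptions. (A1) $C\subset\operatorname{dom}(T)$. (A2) $T$ is continuous on $C$, meaning that $T$ is outer-semicontinuous (i.e. $Gr(T)$ is closed) and inner-semicontinuous at each $x\in C$ (i.e. for every $y\in T(x)$ and every sequence $(x^k)\subset\operatorname{dom}(T)$ with $x^k\to x$ there are $y^k\in T(x^k)$ with $y^k\to y$). (A3) $T$ is locally bounded on $C$: each $x\in C$ has a neighborhood $U$ such that $\bigcup_{y\in U}T(y)$ is bounded. (A4) $S_0\ne\emptyset$. Algorithm F. Fixed parameters: $\delta,\theta\in(0,1)$ and $(\beta_k)_{k\in\mathbb{N}}\subset[\check\beta,\hat\beta]$ with $0<\check\beta\le\hat\beta<+\infty$.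 For $z,v\in\mathbb{R}^n$ put $H(z,v)=\{y\in\mathbb{R}^n:\langle v,y-z\rangle\le0\}$, and for $x\in\mathbb{R}^n$ put $W(x)=\{y\in\mathbb{R}^n:\langle y-x,x^0-x\rangle\le0\}$. Initialization: $x^0\in C$, $\tilde H_{-1}=\mathbb{R}^n$, $k=0$. Step 1: choose any $u^k\in T(x^k)$ and set $z^k=P_C(x^k-\beta_ku^k)$. Linesearch: let $\alpha_k$ be the first $\alpha$ in the list $1,\theta,\theta^2,\dots$ for which there exists $u_\alpha\in T(\alpha z^k+(1-\alpha)x^k)$ with $\langle u_\alpha,x^k-z^k\rangle\ge\delta\langle u^k,x^k-z^k\rangle$, and choose such an element $\bar u^k\in T(\alpha_kz^k+(1-\alpha_k)x^k)$ for $\alpha=\alpha_k$. Step 2: if $z^k=x^k$, or $z^k=P_C(z^k-v^k)$ with $v^k\in T(z^k)$ (a chosen element), stop. Step 3: set $\bar x^k=\alpha_kz^k+(1-\alpha_k)x^k$, $\tilde H_k=\tilde H_{k-1}\cap H(\bar x^k,\bar u^k)$, and $x^{k+1}=P_{C\cap\tilde H_k\cap W(x^k)}(x^0)$. Step 4: if $x^{k+1}=x^k$ stop; otherwise replace $k$ by $k+1$ and go to Step 1. *)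

theory Defs
  imports "HOL-Analysis.Analysis"
begin

text \<open>
  A point-to-set operator is a total set-valued function, with empty values outside its
  domain. The orthogonal projection onto \<open>A\<close> is the library's \<^const>\<open>closest_point\<close> \<open>A\<close>.
\<close>

definition op_dom :: "('a \<Rightarrow> 'b set) \<Rightarrow> 'a set" where
  "op_dom T = {x. T x \<noteq> {}}"

definition op_graph :: "('a \<Rightarrow> 'b set) \<Rightarrow> ('a \<times> 'b) set" where
  "op_graph T = {(x, u). u \<in> T x}"

definition solutions :: "('a::real_inner \<Rightarrow> 'a set) \<Rightarrow> 'a set \<Rightarrow> 'a set" where
  "solutions T C = {xs \<in> C. \<exists>us \<in> T xs. \<forall>x\<in>C. us \<bullet> (x - xs) \<ge> 0}"

definition dual_solutions :: "('a::real_inner \<Rightarrow> 'a set) \<Rightarrow> 'a set \<Rightarrow> 'a set" where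
  "dual_solutions T C = {xs \<in> C. \<forall>x\<in>C. \<forall>u\<in>T x. u \<bullet> (x - xs) \<ge> 0}"

definition outer_semicontinuous ::
    "('a::topological_space \<Rightarrow> 'b::topological_space set) \<Rightarrow> bool" where
  "outer_semicontinuous T \<longleftrightarrow> closed (op_graph T)"

definition inner_semicontinuous_at ::
    "('a::topological_space \<Rightarrow> 'b::topological_space set) \<Rightarrow> 'a \<Rightarrow> bool" where
  "inner_semicontinuous_at T x \<longleftrightarrow>
     (\<forall>y \<in> T x. \<forall>X::nat \<Rightarrow> 'a. (\<forall>k. X k \<in> op_dom T) \<and> X \<longlonglongrightarrow> x \<longrightarrow>
        (\<exists>Y. (\<forall>k. Y k \<in> T (X k)) \<and> Y \<longlonglongrightarrow> y))"

definition continuous_operator_on ::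
    "'a::topological_space set \<Rightarrow> ('a \<Rightarrow> 'b::topological_space set) \<Rightarrow> bool" where
  "continuous_operator_on C T \<longleftrightarrow>
     outer_semicontinuous T \<and> (\<forall>x\<in>C. inner_semicontinuous_at T x)"

definition locally_bounded_operator_on ::
    "'a::topological_space set \<Rightarrow> ('a \<Rightarrow> 'b::metric_space set) \<Rightarrow> bool" where
  "locally_bounded_operator_on C T \<longleftrightarrow>
     (\<forall>x\<in>C. \<exists>U. open U \<and> x \<in> U \<and> bounded (\<Union>y\<in>U. T y))"

definition halfspace_H :: "'a::real_inner \<Rightarrow> 'a \<Rightarrow> 'a set" where
  "halfspace_H z v = {y. v \<bullet> (y - z) \<le> 0}"

definition halfspace_W :: "'a::real_inner \<Rightarrow> 'a \<Rightarrow> 'a set" where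
  "halfspace_W x0 x = {y. (y - x) \<bullet> (x0 - x) \<le> 0}"

text \<open>
  The index is shifted by one: \<open>H_tilde xbar ubar k\<close> stands for $\tilde H_{k-1}$, so that
  $\tilde H_{-1}$ is the value at \<open>0\<close> and $\tilde H_k$ the value at \<open>Suc k\<close>.
\<close>

primrec H_tilde :: "(nat \<Rightarrow> 'a::real_inner) \<Rightarrow> (nat \<Rightarrow> 'a) \<Rightarrow> nat \<Rightarrow> 'a set" where
  "H_tilde xbar ubar 0 = UNIV"
| "H_tilde xbar ubar (Suc k) = H_tilde xbar ubar k \<inter> halfspace_H (xbar k) (ubar k)"

definition linesearch_point :: "'a::real_inner \<Rightarrow> 'a \<Rightarrow> real \<Rightarrow> 'a" where
  "linesearch_point x z a = a *\<^sub>R z + (1 - a) *\<^sub>R x"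

definition linesearch_candidates ::
    "('a::real_inner \<Rightarrow> 'a set) \<Rightarrow> real \<Rightarrow> 'a \<Rightarrow> 'a \<Rightarrow> 'a \<Rightarrow> real \<Rightarrow> 'a set" where
  "linesearch_candidates T \<delta> x z u a =
     {w \<in> T (linesearch_point x z a). w \<bullet> (x - z) \<ge> \<delta> * (u \<bullet> (x - z))}"

text \<open>
  \<open>a\<close> is the first element of \<open>1, \<theta>, \<theta>\<^sup>2, \<dots>\<close> that admits a candidate.
\<close>

definition linesearch_step ::
    "('a::real_inner \<Rightarrow> 'a set) \<Rightarrow> real \<Rightarrow> real \<Rightarrow> 'a \<Rightarrow> 'a \<Rightarrow> 'a \<Rightarrow> real \<Rightarrow> bool" where
  "linesearch_step T \<delta> \<theta> x z u a \<longleftrightarrow>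
     (\<exists>j::nat. a = \<theta> ^ j \<and> linesearch_candidates T \<delta> x z u (\<theta> ^ j) \<noteq> {} \<and>
        (\<forall>i<j. linesearch_candidates T \<delta> x z u (\<theta> ^ i) = {}))"

text \<open>
  The three disequalities say that none of the stopping tests (two in Step 2, one in Step 4)
  ever succeeds. The set projected onto in Step 3 is not required to be nonempty:
  for closed convex \<open>C\<close> with \<open>dual_solutions T C \<noteq> {}\<close> it contains \<open>dual_solutions T C\<close>.
\<close>

definition algorithm_F_infinite_run ::
    "('a::euclidean_space \<Rightarrow> 'a set) \<Rightarrow> 'a set \<Rightarrow> real \<Rightarrow> real \<Rightarrow> (nat \<Rightarrow> real) \<Rightarrow>
     (nat \<Rightarrow> 'a) \<Rightarrow> (nat \<Rightarrow> 'a) \<Rightarrow> (nat \<Rightarrow> 'a) \<Rightarrow> (nat \<Rightarrow> real) \<Rightarrow> (nat \<Rightarrow> 'a) \<Rightarrow>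
     (nat \<Rightarrow> 'a) \<Rightarrow> (nat \<Rightarrow> 'a) \<Rightarrow> bool" where
  "algorithm_F_infinite_run T C \<delta> \<theta> \<beta> x u z \<alpha> ubar v xbar \<longleftrightarrow>
     x 0 \<in> C \<and>
     (\<forall>k. u k \<in> T (x k) \<and>
          z k = closest_point C (x k - \<beta> k *\<^sub>R u k) \<and>
          linesearch_step T \<delta> \<theta> (x k) (z k) (u k) (\<alpha> k) \<and>
          ubar k \<in> linesearch_candidates T \<delta> (x k) (z k) (u k) (\<alpha> k) \<and>
          z k \<noteq> x k \<and>
          v k \<in> T (z k) \<and> z k \<noteq> closest_point C (z k - v k) \<and>
          xbar k = linesearch_point (x k) (z k) (\<alpha> k) \<and>
          x (Suc k) =
            closest_point (C \<inter> H_tilde xbar ubar (Suc k) \<inter> halfspace_W (x 0) (x k)) (x 0) \<and>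
          x (Suc k) \<noteq> x k)"

end

theory Submission
  imports Defs
begin

text \<open>
  Convergence of the iterates is a matter of projections alone. Every iterate is the projection
  of the starting point \<open>x 0\<close> onto the intersection of a set from a decreasing sequence of closed
  convex sets \<open>K\<close> with the half-space \<open>W(x k)\<close>, and the variational inequality for the projection
  says exactly that this intersection lies in \<open>W(x (Suc k))\<close>. Hence, by induction, \<open>W(x k)\<close>
  contains all points common to the earlier sets \<open>K\<close>, in particular all later iterates. For a
  point \<open>y\<close> of \<open>W(x k)\<close> the angle at \<open>x k\<close> in the triangle \<open>x 0\<close>, \<open>x k\<close>, \<open>y\<close> is at least a
  right angle, so \<open>\<bar>y - x k\<bar>\<^sup>2 \<le> \<bar>y - x 0\<bar>\<^sup>2 - \<bar>x k - x 0\<bar>\<^sup>2\<close>. The distances to \<open>x 0\<close> therefore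
  increase. They are bounded by the distance from \<open>x 0\<close> to a point of \<open>dual_solutions T C\<close>, which
  no cut removes because its defining inequality holds at every \<open>xbar k\<close>. So these distances
  converge, and the iterates form a Cauchy sequence (\<open>successive_projections_convergent\<close>).

  The limit is a solution because the hyperplane through \<open>xbar k\<close> separates \<open>x (Suc k)\<close> from
  \<open>x k\<close>, at a depth that a multiple of \<open>\<alpha> k * \<bar>x k - z k\<bar>\<^sup>2\<close> bounds from below
  (\<open>linesearch_cut_depth\<close>). As the iterates converge and \<open>ubar\<close> is bounded, this quantity tends
  to \<open>0\<close>. Pass to a subsequence along which \<open>u\<close>, \<open>\<beta>\<close> and \<open>\<alpha>\<close> converge, so that \<open>z\<close> converges
  too. If the limit of \<open>\<alpha>\<close> is positive, then \<open>x k - z k\<close> tends to \<open>0\<close>. If it is \<open>0\<close>, the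
  previous step \<open>\<alpha> k / \<theta>\<close> was rejected, at a trial point that also tends to the limit \<open>p\<close> of
  the iterates, and inner semicontinuity turns the rejection into
  \<open>u \<bullet> (p - z) \<le> \<delta> * (u \<bullet> (p - z))\<close> for the limits \<open>u\<close> and \<open>z\<close>, which again forces \<open>p = z\<close>.
  So \<open>p\<close> is a fixed point of the projected step, that is, a solution
  (\<open>limit_of_linesearch_is_solution\<close>).
\<close>

section \<open>Projected steps\<close>

lemma projected_step_descent:
  fixes C :: "'a::euclidean_space set"
  assumes "closed C" "convex C" "x \<in> C" and z: "z = closest_point C (x - b *\<^sub>R u)"
  shows "(norm (x - z))\<^sup>2 \<le> b * (u \<bullet> (x - z))"
proof -
  have "(x - b *\<^sub>R u - z) \<bullet> (x - z) \<le> 0"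
    using closest_point_dot[OF assms(2,1,3)] by (simp add: z)
  thus ?thesis
    by (simp add: power2_norm_eq_inner inner_diff_left algebra_simps)
qed

lemma projected_step_fixed_point_solution:
  fixes C :: "'a::euclidean_space set"
  assumes C: "closed C" "convex C" and p: "p \<in> C" "w \<in> T p"
    and b: "b > 0" and fixp: "closest_point C (p - b *\<^sub>R w) = p"
  shows "p \<in> solutions T C"
proof -
  have "w \<bullet> (y - p) \<ge> 0" if "y \<in> C" for y
  proof -
    have "(p - b *\<^sub>R w - p) \<bullet> (y - p) \<le> 0"
      using closest_point_dot[OF C(2,1) that, of "p - b *\<^sub>R w"] by (simp add: fixp)
    thus ?thesis using b by (simp add: zero_le_mult_iff)
  qed
  thus ?thesis using p by (auto simp: solutions_def)
qed

lemma linesearch_point_in_convex: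
  assumes "convex C" "x \<in> C" "z \<in> C" "0 \<le> a" "a \<le> 1"
  shows "linesearch_point x z a \<in> C"
  unfolding linesearch_point_def using assms by (intro convexD) auto

lemma bounded_image_compact:
  fixes T :: "'a::euclidean_space \<Rightarrow> 'b::metric_space set"
  assumes lb: "locally_bounded_operator_on C T" and K: "compact K" "K \<subseteq> C"
  shows "bounded (\<Union>y\<in>K. T y)"
proof -
  have "\<forall>q\<in>K. \<exists>U. open U \<and> q \<in> U \<and> bounded (\<Union>y\<in>U. T y)"
    using lb K(2) by (auto simp: locally_bounded_operator_on_def)
  then obtain U where U: "\<And>q. q \<in> K \<Longrightarrow> open (U q) \<and> q \<in> U q \<and> bounded (\<Union>y\<in>U q. T y)"
    by metis
  obtain D where D: "D \<subseteq> K" "finite D" "K \<subseteq> (\<Union>q\<in>D. U q)"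
    using compactE_image[OF K(1), of K U] U by blast
  have "bounded (\<Union>q\<in>D. \<Union>y\<in>U q. T y)"
    using D U by (intro bounded_UN) auto
  thus ?thesis by (rule bounded_subset) (use D(3) in blast)
qed

section \<open>Convergence of the iterated projections\<close>

lemma closed_convex_halfspace_W: "closed (halfspace_W x0 x)" "convex (halfspace_W x0 x)"
proof -
  have "halfspace_W x0 x = {y. (x0 - x) \<bullet> y \<le> (x0 - x) \<bullet> x}"
    by (auto simp: halfspace_W_def inner_diff_left inner_diff_right inner_commute)
  thus "closed (halfspace_W x0 x)" "convex (halfspace_W x0 x)"
    by (auto simp: closed_halfspace_le convex_halfspace_le)
qed

lemma closed_convex_halfspace_H: "closed (halfspace_H x v)" "convex (halfspace_H x v)"
proof -
  have "halfspace_H x v = {y. v \<bullet> y \<le> v \<bullet> x}"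
    by (auto simp: halfspace_H_def inner_diff_right)
  thus "closed (halfspace_H x v)" "convex (halfspace_H x v)"
    by (auto simp: closed_halfspace_le convex_halfspace_le)
qed

lemma closed_convex_H_tilde: "closed (H_tilde xb ub k) \<and> convex (H_tilde xb ub k)"
  by (induction k) (auto simp: closed_convex_halfspace_H intro!: closed_Int convex_Int)

lemma halfspace_W_obtuse:
  assumes "y \<in> halfspace_W x0 x"
  shows "(norm (y - x))\<^sup>2 \<le> (norm (y - x0))\<^sup>2 - (norm (x - x0))\<^sup>2"
proof -
  have "(norm (y - x0))\<^sup>2 = (norm (y - x))\<^sup>2 + (norm (x - x0))\<^sup>2 - 2 * ((y - x) \<bullet> (x0 - x))"
    by (simp add: power2_norm_eq_inner inner_diff_left inner_diff_right inner_commute)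
  thus ?thesis using assms by (simp add: halfspace_W_def)
qed

text \<open>
  Only the sets \<open>K\<close> accumulate, whereas a new half-space replaces the old one. Nothing is lost:
  the projection onto \<open>K k \<inter> halfspace_W (x 0) (x k)\<close> has this whole set in its own half-space,
  so that the constraints of the earlier steps persist by induction.

  The hypothesis on \<open>s\<close> is conditional because, in the algorithm, the sets \<open>K k\<close> are built from
  the iterates themselves: that \<open>s\<close> lies in \<open>K k\<close> is known only once the preceding projections
  are known to be genuine, that is, onto nonempty sets.
\<close>

lemma successive_projections_convergent:
  fixes x :: "nat \<Rightarrow> 'a::euclidean_space"
  assumes K: "\<And>k. closed (K k)" "\<And>k. convex (K k)" "decseq K"
    and s: "\<And>k. (\<And>i. i < k \<Longrightarrow> x (Suc i) \<in> K i) \<Longrightarrow> s \<in> K k"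
    and step: "\<And>k. x (Suc k) = closest_point (K k \<inter> halfspace_W (x 0) (x k)) (x 0)"
  shows "convergent x" and "x (Suc k) \<in> K k"
proof -
  let ?W = "\<lambda>k. halfspace_W (x 0) (x k)"
  have W: "y \<in> ?W k" if "\<forall>i<k. y \<in> K i" for y k
    using that
  proof (induction k)
    case 0
    show ?case by (simp add: halfspace_W_def)
  next
    case (Suc k)
    hence "y \<in> K k \<inter> ?W k" by simp
    moreover have "convex (K k \<inter> ?W k)" "closed (K k \<inter> ?W k)"
      by (auto simp: K closed_convex_halfspace_W intro: closed_Int convex_Int)
    ultimately have "(x 0 - x (Suc k)) \<bullet> (y - x (Suc k)) \<le> 0"
      unfolding step[of k] by (intro closest_point_dot)
    thus ?case by (simp add: halfspace_W_def inner_commute)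
  qed
  have inK: "x (Suc k) \<in> K k" for k
  proof (induction k rule: less_induct)
    case (less k)
    hence "s \<in> K i" if "i \<le> k" for i using that by (intro s) auto
    hence "s \<in> K k \<inter> ?W k" using W[of k s] by simp
    hence "x (Suc k) \<in> K k \<inter> ?W k"
      unfolding step[of k]
      by (intro closest_point_in_set) (auto simp: K closed_convex_halfspace_W)
    thus ?case by blast
  qed
  thus "x (Suc k) \<in> K k" .
  have sK: "s \<in> K k" for k by (intro s inK)
  have later: "x j \<in> ?W k" if "k \<le> j" for k j
  proof (rule W, intro allI impI)
    fix i assume "i < k"
    with that obtain j' where "j = Suc j'" "i \<le> j'" by (cases j) auto
    thus "x j \<in> K i" using inK[of j'] decseqD[OF K(3)] by blast
  qed
  define d where "d k = (norm (x k - x 0))\<^sup>2" for k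
  have gap: "(norm (x j - x k))\<^sup>2 \<le> d j - d k" if "k \<le> j" for k j
    unfolding d_def using halfspace_W_obtuse[OF later[OF that]] .
  have "incseq d"
    using gap by (intro monoI) (meson diff_ge_0_iff_ge order_trans zero_le_power2)
  moreover have "d k \<le> (norm (s - x 0))\<^sup>2" for k
  proof -
    have "s \<in> ?W k" using W sK by blast
    from halfspace_W_obtuse[OF this] show ?thesis
      unfolding d_def using zero_le_power2[of "norm (s - x k)"] by linarith
  qed
  ultimately obtain L where "d \<longlonglongrightarrow> L"
    using incseq_convergent by metis
  hence Cd: "Cauchy d" by (rule LIMSEQ_imp_Cauchy)
  have "Cauchy x"
  proof (rule metric_CauchyI)
    fix e :: real assume "e > 0"
    then obtain N where N: "\<And>m n. m \<ge> N \<Longrightarrow> n \<ge> N \<Longrightarrow> dist (d m) (d n) < e\<^sup>2"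
      using metric_CauchyD[OF Cd, of "e\<^sup>2"] by auto
    have close: "norm (x n - x m) < e" if "m \<ge> N" "m \<le> n" for m n
    proof -
      have "(norm (x n - x m))\<^sup>2 < e\<^sup>2"
        using gap[OF that(2)] N[of n m] that by (simp add: dist_real_def)
      thus ?thesis using \<open>e > 0\<close> by (simp add: power_less_imp_less_base)
    qed
    have "dist (x m) (x n) < e" if "m \<ge> N" "n \<ge> N" for m n
      using close[of m n] close[of n m] that
      by (cases "m \<le> n") (auto simp: dist_norm norm_minus_commute)
    thus "\<exists>N. \<forall>m\<ge>N. \<forall>n\<ge>N. dist (x m) (x n) < e" by blast
  qed
  thus "convergent x" by (simp add: Cauchy_convergent)
qed

section \<open>Limits of the linesearch\<close>

lemma linesearch_step_range:
  assumes "linesearch_step T \<delta> \<theta> x z u a" "0 < \<theta>" "\<theta> < 1"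
  shows "0 < a" "a \<le> 1"
  using assms by (auto simp: linesearch_step_def power_le_one)

lemma linesearch_step_previous_rejected:
  assumes "linesearch_step T \<delta> \<theta> x z u a" "0 < \<theta>" "a < 1"
  shows "linesearch_candidates T \<delta> x z u (a / \<theta>) = {}"
proof -
  from assms(1) obtain j where j: "a = \<theta> ^ j"
    "\<forall>i<j. linesearch_candidates T \<delta> x z u (\<theta> ^ i) = {}"
    by (auto simp: linesearch_step_def)
  with assms(3) obtain i where "j = Suc i" by (cases j) auto
  thus ?thesis using j assms(2) by simp
qed

text \<open>
  This is the statement about a subsequence along which all the data of the linesearch converge.
  The limit \<open>Z\<close> of the projected steps is \<open>closest_point C (p - b *\<^sub>R w)\<close>, and what has to be
  seen is that \<open>Z = p\<close>.
\<close>

lemma limit_of_linesearch_is_solution: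
  fixes C :: "'a::euclidean_space set"
  assumes C: "closed C" "convex C" and A1: "C \<subseteq> op_dom T"
    and A2: "continuous_operator_on C T"
    and pars: "\<delta> < 1" "0 < \<theta>" "\<theta> < 1" "b > 0"
    and xC: "\<And>k. x k \<in> C" and uT: "\<And>k. u k \<in> T (x k)"
    and z: "\<And>k. z k = closest_point C (x k - \<beta> k *\<^sub>R u k)"
    and ls: "\<And>k. linesearch_step T \<delta> \<theta> (x k) (z k) (u k) (\<alpha> k)"
    and lim: "x \<longlonglongrightarrow> p" "u \<longlonglongrightarrow> w" "\<beta> \<longlonglongrightarrow> b" "\<alpha> \<longlonglongrightarrow> a"
    and cut: "(\<lambda>k. \<alpha> k * (norm (x k - z k))\<^sup>2) \<longlonglongrightarrow> 0"
  shows "p \<in> solutions T C"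
proof -
  have Cne: "C \<noteq> {}" using xC by blast
  have pC: "p \<in> C" using closed_sequentially[OF C(1)] xC lim(1) by blast
  have "(p, w) \<in> op_graph T"
  proof (rule closed_sequentially)
    show "closed (op_graph T)"
      using A2 by (simp add: continuous_operator_on_def outer_semicontinuous_def)
    show "(x k, u k) \<in> op_graph T" for k using uT by (simp add: op_graph_def)
    show "(\<lambda>k. (x k, u k)) \<longlonglongrightarrow> (p, w)" by (intro tendsto_Pair lim)
  qed
  hence wT: "w \<in> T p" by (simp add: op_graph_def)
  define Z where "Z = closest_point C (p - b *\<^sub>R w)"
  have "isCont (closest_point C) (p - b *\<^sub>R w)"
    by (rule continuous_at_closest_point) (use C Cne in auto)
  moreover have "(\<lambda>k. x k - \<beta> k *\<^sub>R u k) \<longlonglongrightarrow> p - b *\<^sub>R w"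
    by (intro tendsto_intros lim)
  ultimately have "(\<lambda>k. closest_point C (x k - \<beta> k *\<^sub>R u k)) \<longlonglongrightarrow> Z"
    unfolding Z_def by (rule isCont_tendsto_compose)
  hence zZ: "z \<longlonglongrightarrow> Z" by (simp flip: z)
  have zC: "z k \<in> C" for k
    unfolding z by (rule closest_point_in_set) (use C Cne in auto)
  have \<alpha>: "0 < \<alpha> k" "\<alpha> k \<le> 1" for k
    using linesearch_step_range[OF ls pars(2,3)] by auto
  have "Z = p"
  proof (cases "a = 0")
    case False
    have "(\<lambda>k. \<alpha> k * (norm (x k - z k))\<^sup>2) \<longlonglongrightarrow> a * (norm (p - Z))\<^sup>2"
      by (intro tendsto_intros lim zZ)
    hence "a * (norm (p - Z))\<^sup>2 = 0" using cut LIMSEQ_unique by blast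
    thus ?thesis using False by simp
  next
    case True
    \<comment> \<open>The truncation at \<open>1\<close> keeps the trial points in \<open>C\<close> for the finitely many indices at
      which \<open>\<alpha> k / \<theta>\<close> exceeds \<open>1\<close>.\<close>
    define y where "y k = linesearch_point (x k) (z k) (min 1 (\<alpha> k / \<theta>))" for k
    have "(\<lambda>k. min 1 (\<alpha> k / \<theta>)) \<longlonglongrightarrow> min 1 (a / \<theta>)"
      by (intro tendsto_intros lim) (use pars in auto)
    hence m0: "(\<lambda>k. min 1 (\<alpha> k / \<theta>)) \<longlonglongrightarrow> 0" using True by simp
    have "y \<longlonglongrightarrow> 0 *\<^sub>R Z + (1 - 0) *\<^sub>R p"
      unfolding y_def linesearch_point_def by (intro tendsto_intros m0 zZ lim)
    hence yp: "y \<longlonglongrightarrow> p" by simp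
    have "y k \<in> C" for k
      unfolding y_def by (rule linesearch_point_in_convex)
        (use C xC zC \<alpha>[of k] pars in \<open>auto intro: less_imp_le\<close>)
    hence "\<forall>k. y k \<in> op_dom T" using A1 by blast
    with A2 pC wT yp obtain Y where Y: "\<And>k. Y k \<in> T (y k)" "Y \<longlonglongrightarrow> w"
      unfolding continuous_operator_on_def inner_semicontinuous_at_def by meson
    have "\<forall>\<^sub>F k in sequentially. \<alpha> k < \<theta>"
      using order_tendstoD(2)[OF lim(4), of \<theta>] True pars by simp
    \<comment> \<open>Every value of \<open>T\<close> at the rejected point violates the test, in particular the one
      chosen close to \<open>w\<close>.\<close>
    hence "\<forall>\<^sub>F k in sequentially. Y k \<bullet> (x k - z k) \<le> \<delta> * (u k \<bullet> (x k - z k))"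
    proof eventually_elim
      case (elim k)
      hence "min 1 (\<alpha> k / \<theta>) = \<alpha> k / \<theta>" using pars by (simp add: min_def)
      hence "Y k \<in> T (linesearch_point (x k) (z k) (\<alpha> k / \<theta>))"
        using Y(1)[of k] by (simp add: y_def)
      moreover have "linesearch_candidates T \<delta> (x k) (z k) (u k) (\<alpha> k / \<theta>) = {}"
        using linesearch_step_previous_rejected[OF ls] elim pars by simp
      ultimately show ?case by (auto simp: linesearch_candidates_def)
    qed
    moreover have "(\<lambda>k. Y k \<bullet> (x k - z k)) \<longlonglongrightarrow> w \<bullet> (p - Z)"
      "(\<lambda>k. \<delta> * (u k \<bullet> (x k - z k))) \<longlonglongrightarrow> \<delta> * (w \<bullet> (p - Z))"
      by (intro tendsto_intros Y lim zZ)+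
    ultimately have "w \<bullet> (p - Z) \<le> \<delta> * (w \<bullet> (p - Z))"
      using tendsto_le[OF sequentially_bot] by blast
    hence "(1 - \<delta>) * (w \<bullet> (p - Z)) \<le> 0" by (simp add: algebra_simps)
    hence "w \<bullet> (p - Z) \<le> 0" using pars by (simp add: mult_le_0_iff)
    hence "b * (w \<bullet> (p - Z)) \<le> 0" using pars by (simp add: mult_le_0_iff)
    hence "(norm (p - Z))\<^sup>2 \<le> 0"
      using projected_step_descent[OF C pC Z_def] by linarith
    thus ?thesis by simp
  qed
  thus ?thesis
    using projected_step_fixed_point_solution[of C p w T b] C pC wT pars by (simp add: Z_def)
qed

section \<open>The cuts of an infinite run\<close>

lemma dual_solutions_subset_H_tilde:
  assumes "s \<in> dual_solutions T C" "\<And>i. i < k \<Longrightarrow> xb i \<in> C" "\<And>i. i < k \<Longrightarrow> ub i \<in> T (xb i)"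
  shows "s \<in> H_tilde xb ub k"
  using assms(2,3)
proof (induction k)
  case (Suc k)
  have "ub k \<bullet> (xb k - s) \<ge> 0"
    using assms(1) Suc.prems by (auto simp: dual_solutions_def)
  hence "s \<in> halfspace_H (xb k) (ub k)"
    by (simp add: halfspace_H_def inner_diff_right)
  thus ?case using Suc by simp
qed simp

text \<open>
  A point \<open>y\<close> beyond the hyperplane through the accepted trial point cannot be close to \<open>x\<close>
  unless the residual \<open>x - z\<close> or the step \<open>a\<close> is small.
\<close>

lemma linesearch_cut_depth:
  fixes C :: "'a::euclidean_space set"
  assumes C: "closed C" "convex C" "x \<in> C"
    and z: "z = closest_point C (x - b *\<^sub>R u)" and b: "0 < b" "b \<le> B"
    and pars: "0 < \<delta>" "0 \<le> a"
    and ub: "ub \<in> linesearch_candidates T \<delta> x z u a"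
    and y: "y \<in> halfspace_H (linesearch_point x z a) ub"
  shows "a * (norm (x - z))\<^sup>2 \<le> B / \<delta> * (norm ub * norm (x - y))"
proof -
  have desc: "(norm (x - z))\<^sup>2 \<le> b * (u \<bullet> (x - z))"
    using projected_step_descent[OF C z] .
  hence "0 \<le> b * (u \<bullet> (x - z))" using zero_le_power2 order_trans by blast
  hence "0 \<le> u \<bullet> (x - z)" using b by (simp add: zero_le_mult_iff)
  hence "(norm (x - z))\<^sup>2 \<le> B * (u \<bullet> (x - z))"
    using desc b(2) by (meson mult_right_mono order_trans)
  hence "\<delta> * (norm (x - z))\<^sup>2 \<le> B * (\<delta> * (u \<bullet> (x - z)))"
    using pars by (simp add: mult.left_commute)
  also have "\<dots> \<le> B * (ub \<bullet> (x - z))"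
    using ub b by (intro mult_left_mono) (auto simp: linesearch_candidates_def)
  finally have "a * (\<delta> * (norm (x - z))\<^sup>2) \<le> a * (B * (ub \<bullet> (x - z)))"
    using pars by (intro mult_left_mono)
  also have "\<dots> = B * (ub \<bullet> (x - linesearch_point x z a))"
    by (simp add: linesearch_point_def inner_diff_right inner_add_right algebra_simps)
  also have "\<dots> \<le> B * (ub \<bullet> (x - y))"
    using y b by (intro mult_left_mono) (auto simp: halfspace_H_def inner_diff_right)
  also have "\<dots> \<le> B * (norm ub * norm (x - y))"
    using b by (intro mult_left_mono norm_cauchy_schwarz) auto
  finally show ?thesis using pars by (simp add: field_simps)
qed

section \<open>Convergence to a solution\<close>

theorem theorem4p11:
  fixes T :: "real ^ 'n \<Rightarrow> (real ^ 'n) set"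
    and C :: "(real ^ 'n) set"
    and \<delta> \<theta> \<beta>lo \<beta>hi :: real
    and \<beta> \<alpha> :: "nat \<Rightarrow> real"
    and x u z ubar v xbar :: "nat \<Rightarrow> real ^ 'n"
  assumes C: "C \<noteq> {}" "closed C" "convex C"
    and A1: "C \<subseteq> op_dom T"
    and A2: "continuous_operator_on C T"
    and A3: "locally_bounded_operator_on C T"
    and A4: "dual_solutions T C \<noteq> {}"
    and \<delta>: "0 < \<delta>" "\<delta> < 1"
    and \<theta>: "0 < \<theta>" "\<theta> < 1"
    and \<beta>: "0 < \<beta>lo" "\<beta>lo \<le> \<beta>hi" "\<And>k. \<beta> k \<in> {\<beta>lo..\<beta>hi}"
    and run: "algorithm_F_infinite_run T C \<delta> \<theta> \<beta> x u z \<alpha> ubar v xbar"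
    and not_sol: "\<And>k. x k \<notin> solutions T C"
  shows "\<exists>p \<in> solutions T C. x \<longlonglongrightarrow> p"
proof -
  have x0: "x 0 \<in> C" and uT: "\<And>k. u k \<in> T (x k)"
    and z: "\<And>k. z k = closest_point C (x k - \<beta> k *\<^sub>R u k)"
    and ls: "\<And>k. linesearch_step T \<delta> \<theta> (x k) (z k) (u k) (\<alpha> k)"
    and cand: "\<And>k. ubar k \<in> linesearch_candidates T \<delta> (x k) (z k) (u k) (\<alpha> k)"
    and xbar: "\<And>k. xbar k = linesearch_point (x k) (z k) (\<alpha> k)"
    and step: "\<And>k. x (Suc k) =
      closest_point (C \<inter> H_tilde xbar ubar (Suc k) \<inter> halfspace_W (x 0) (x k)) (x 0)"
    using run unfolding algorithm_F_infinite_run_def by blast+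
  have \<alpha>: "0 < \<alpha> k" "\<alpha> k \<le> 1" for k
    using linesearch_step_range[OF ls \<theta>] by auto
  have \<beta>': "0 < \<beta> k" "\<beta> k \<le> \<beta>hi" "\<beta>lo \<le> \<beta> k" for k
    using \<beta>(3)[of k] \<beta>(1) by auto
  have zC: "z k \<in> C" for k
    unfolding z by (rule closest_point_in_set) (use C in auto)
  have ubT: "ubar k \<in> T (xbar k)" for k
    using cand[of k] by (simp add: linesearch_candidates_def xbar)
  obtain s where s: "s \<in> dual_solutions T C" using A4 by blast

  define K where "K k = C \<inter> H_tilde xbar ubar (Suc k)" for k
  have K: "closed (K k)" "convex (K k)" for k
    using closed_convex_H_tilde[of xbar ubar "Suc k"] C
    by (auto simp: K_def simp del: H_tilde.simps intro: closed_Int convex_Int)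
  have decK: "decseq K" by (rule decseq_SucI) (auto simp: K_def)
  have sK: "s \<in> K k" if "\<And>i. i < k \<Longrightarrow> x (Suc i) \<in> K i" for k
  proof -
    have "x i \<in> C" if "i < Suc k" for i
      using x0 \<open>\<And>i. i < k \<Longrightarrow> x (Suc i) \<in> K i\<close> that by (cases i) (auto simp: K_def)
    hence "xbar i \<in> C" if "i < Suc k" for i
      unfolding xbar using that C zC \<alpha>[of i] by (intro linesearch_point_in_convex) auto
    hence "s \<in> H_tilde xbar ubar (Suc k)"
      using s ubT by (intro dual_solutions_subset_H_tilde) auto
    thus ?thesis using s by (simp add: K_def dual_solutions_def)
  qed
  note proj = successive_projections_convergent[OF K decK sK step[folded K_def]]
  obtain p where xp: "x \<longlonglongrightarrow> p" using proj(1) by (auto simp: convergent_def)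
  have xC: "x k \<in> C" for k
    using x0 proj(2)[of "k - 1"] by (cases k) (auto simp: K_def)
  have xbarC: "xbar k \<in> C" for k
    unfolding xbar using C zC xC \<alpha>[of k] by (intro linesearch_point_in_convex) auto

  have image_bounded: "\<exists>B. \<forall>k. norm (f k) \<le> B"
    if b: "\<And>k. norm (y k) \<le> R" and yC: "\<And>k. y k \<in> C" and fT: "\<And>k. f k \<in> T (y k)"
    for y f :: "nat \<Rightarrow> real ^ 'n" and R
  proof -
    have "bounded (\<Union>q\<in>C \<inter> cball 0 R. T q)"
      by (rule bounded_image_compact[OF A3]) (use C in \<open>auto intro: closed_Int_compact\<close>)
    moreover have "f k \<in> (\<Union>q\<in>C \<inter> cball 0 R. T q)" for k
      using b[of k] yC[of k] fT[of k] by (intro UN_I[of "y k"]) auto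
    ultimately show ?thesis unfolding bounded_iff by blast
  qed
  obtain R where R: "\<And>k. norm (x k) \<le> R"
    using convergent_imp_bounded[OF xp] by (auto simp: bounded_iff)
  obtain M where M: "\<And>k. norm (u k) \<le> M"
    using image_bounded[of x R u, OF R xC uT] by blast

  \<comment> \<open>The projected points are bounded because \<open>z k\<close> is within \<open>\<beta> k * \<bar>u k\<bar>\<close> of \<open>x k\<close>.\<close>
  have zx: "norm (x k - z k) \<le> \<beta>hi * M" for k
  proof -
    have "closest_point C (x k) = x k" using xC by (rule closest_point_self)
    hence "norm (x k - z k) \<le> dist (x k) (x k - \<beta> k *\<^sub>R u k)"
      unfolding z using closest_point_lipschitz[OF C(3,2,1), of "x k" "x k - \<beta> k *\<^sub>R u k"]
      by (simp add: dist_norm)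
    also have "\<dots> = \<beta> k * norm (u k)" using \<beta>'[of k] by (simp add: dist_norm)
    also have "\<dots> \<le> \<beta>hi * M" using \<beta>'[of k] M[of k] by (intro mult_mono) auto
    finally show ?thesis .
  qed
  have "norm (xbar k) \<le> R + \<beta>hi * M" for k
  proof -
    have "xbar k = x k - \<alpha> k *\<^sub>R (x k - z k)"
      by (simp add: xbar linesearch_point_def algebra_simps)
    hence "norm (xbar k) \<le> norm (x k) + \<alpha> k * norm (x k - z k)"
      using norm_triangle_ineq4[of "x k" "\<alpha> k *\<^sub>R (x k - z k)"] \<alpha>(1)[of k] by simp
    also have "\<alpha> k * norm (x k - z k) \<le> norm (x k - z k)"
      using \<alpha>[of k] by (simp add: mult_left_le_one_le)
    finally show ?thesis using R[of k] zx[of k] by linarith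
  qed
  from image_bounded[of xbar _ ubar, OF this xbarC ubT]
  obtain N where N: "\<And>k. norm (ubar k) \<le> N" by blast

  have cut: "(\<lambda>k. \<alpha> k * (norm (x k - z k))\<^sup>2) \<longlonglongrightarrow> 0"
  proof (rule real_tendsto_sandwich[where f = "\<lambda>_. 0"
        and h = "\<lambda>k. \<beta>hi / \<delta> * (N * norm (x k - x (Suc k)))"])
    have "(\<lambda>k. \<beta>hi / \<delta> * (N * norm (x k - x (Suc k)))) \<longlonglongrightarrow> \<beta>hi / \<delta> * (N * norm (p - p))"
      by (intro tendsto_intros xp LIMSEQ_Suc)
    thus "(\<lambda>k. \<beta>hi / \<delta> * (N * norm (x k - x (Suc k)))) \<longlonglongrightarrow> 0" by simp
    have "\<alpha> k * (norm (x k - z k))\<^sup>2 \<le> \<beta>hi / \<delta> * (N * norm (x k - x (Suc k)))" for k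
    proof -
      have "x (Suc k) \<in> halfspace_H (linesearch_point (x k) (z k) (\<alpha> k)) (ubar k)"
        using proj(2)[of k] by (simp add: K_def xbar)
      hence "\<alpha> k * (norm (x k - z k))\<^sup>2 \<le> \<beta>hi / \<delta> * (norm (ubar k) * norm (x k - x (Suc k)))"
        using C(2,3) xC z \<beta>'(1,2) \<delta>(1) less_imp_le[OF \<alpha>(1)] cand
        by (intro linesearch_cut_depth[where C = C and b = "\<beta> k" and u = "u k" and T = T])
      also have "\<dots> \<le> \<beta>hi / \<delta> * (N * norm (x k - x (Suc k)))"
        using N[of k] \<beta> \<delta> by (intro mult_left_mono mult_right_mono) auto
      finally show ?thesis .
    qed
    thus "\<forall>\<^sub>F k in sequentially.
        \<alpha> k * (norm (x k - z k))\<^sup>2 \<le> \<beta>hi / \<delta> * (N * norm (x k - x (Suc k)))" by simp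
    show "\<forall>\<^sub>F k in sequentially. 0 \<le> \<alpha> k * (norm (x k - z k))\<^sup>2"
      using \<alpha>(1) by (simp add: less_imp_le)
  qed simp

  have "compact (cball (0 :: real ^ 'n) M \<times> {\<beta>lo..\<beta>hi} \<times> {0..1::real})"
    by (intro compact_Times) auto
  moreover have "\<forall>k. (u k, \<beta> k, \<alpha> k) \<in> cball 0 M \<times> {\<beta>lo..\<beta>hi} \<times> {0..1}"
    using M \<beta>(3) \<alpha> by (auto intro: less_imp_le)
  ultimately obtain w b a r where wba: "(w, b, a) \<in> cball 0 M \<times> {\<beta>lo..\<beta>hi} \<times> {0..1}"
    and r: "strict_mono r" "((\<lambda>k. (u k, \<beta> k, \<alpha> k)) \<circ> r) \<longlonglongrightarrow> (w, b, a)"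
    unfolding compact_def by (metis (no_types, lifting) prod_cases3)
  have sub: "(\<lambda>k. u (r k)) \<longlonglongrightarrow> w" "(\<lambda>k. \<beta> (r k)) \<longlonglongrightarrow> b" "(\<lambda>k. \<alpha> (r k)) \<longlonglongrightarrow> a"
    using tendsto_fst[OF r(2)] tendsto_fst[OF tendsto_snd[OF r(2)]]
      tendsto_snd[OF tendsto_snd[OF r(2)]] by (simp_all add: o_def)
  have "b > 0" using wba \<beta> by simp
  moreover have "(\<lambda>k. x (r k)) \<longlonglongrightarrow> p"
    using LIMSEQ_subseq_LIMSEQ[OF xp r(1)] by (simp add: o_def)
  moreover have "(\<lambda>k. \<alpha> (r k) * (norm (x (r k) - z (r k)))\<^sup>2) \<longlonglongrightarrow> 0"
    using LIMSEQ_subseq_LIMSEQ[OF cut r(1)] by (simp add: o_def)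
  ultimately have "p \<in> solutions T C"
    using limit_of_linesearch_is_solution[OF C(2,3) A1 A2 \<delta>(2) \<theta> _ xC uT z ls _ sub] by blast
  thus ?thesis using xp by blast
qed

end
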